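(* Let $(\Omega,\Sigma,\mu)$ be a complete finite measure space and let $X(\mu)$ and $Y(\mu)$ be Banach function spaces such that $X(\mu)\subseteq Y(\mu)$ and $Y(\mu)$ has the Fatou property. For an operator (not necessarily linear map) $T:X(\mu)\to Y(\mu)$ the following are equivalent. (i) $T$ is strongly lattice Lipschitz. (ii) There exist a strongly measurable function $\Phi:\Omega\to Lip_0(\mathbb R)$ such that $T=T_\Phi$, i.e. for every $f\in X(\mu)$, $T(f)(w)=\Phi(w)(f(w))$ for $\mu$-a.e. $w$, and a sequence $(\Phi_n)_n\subset L^\infty(\mu,Lip_0(\mathbb R))$ of essentially bounded functions $\Phi_n:\Omega\to Lip_0(\mathbb R)$ such that $(\Phi_n)_n$ converges $\mu$-a.e. to $\Phi$ (that is, $Lip(\Phi_n(w)-\Phi(w))\to 0$ for $\mu$-a.e. $w$) and $$\sup_n \big\| Lip(\Phi_n(\cdot))\big\|_{\mathcal M(X,Y)}<\infty .$$ Moreover, in this case the sequence $(\Phi_n)_n$ can be chosen in such a way that $$\sup_n \|\Phi_n\|_{\mathcal M(X,Y)(\mu,Lip_0(\mathbb R))}=\|\Phi\|_{\mathcal M(X,Y)(\mu,Lip_0(\mathbb R))}.$$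
   Context: All functions are real-valued; $L^0(\mu)$ is the space of $\mu$-a.e. classes of measurable real functions on $\Omega$. A Banach function space $X(\mu)$ is a linear subspace of $L^0(\mu)$ which is an ideal for the $\mu$-a.e. order (if $|f|\le|g|$ a.e., $f \in L^0(\mu)$, $g\in X(\mu)$, then $f\in X(\mu)$), is a Banach space, satisfies $\|f\|_{X(\mu)}\le\|g\|_{X(\mu)}$ whenever $f,g\in X(\mu)$, $|f|\le|g|$ a.e., and contains $\chi_\Omega$. $Y(\mu)$ has the Fatou property if, for every increasing norm-bounded sequence $(f_n)_n$ in $Y(\mu)$ converging $\mu$-a.e. to a measurable function $f$, one has $f\in Y(\mu)$. $\mathcal M(X,Y)=\mathcal M(X(\mu),Y(\mu))$ is the space of (classes of) measurable functions $h$ such that $hf\in Y(\mu)$ for all $f\in X(\mu)$, with the norm of the multiplication operator $M_h:X(\mu)\to Y(\mu)$, $M_h(f)=hf$. $Lip_0(\mathbb R)$ is the Banach space of Lipschitz functions $\varphi:\mathbb R\to\mathbb R$ with $\varphi(0)=0$, normed by the Lipschitz constant $Lip(\varphi)$. For a Banach space $E$, a function $\Psi:\Omega\to E$ is strongly measurable if it is the $\mu$-a.e. norm limit of a sequence of simple functions $\sum_{i=1}^n x_i\chi_{A_i}$ ($x_i\in E$, $A_i\in\Sigma$ disjoint). The space $\mathcal M(X,Y)(\mu,Lip_0(\mathbb R))$ consists of the strongly measurable $\Psi:\Omega\to Lip_0(\mathbb R)$ such that $w\mapsto Lip(\Psi(w))$ belongs to $\mathcal M(X,Y)$, with norm $\|\Psi\|=\|Lip(\Psi(\cdot))\|_{\mathcal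 M(X,Y)}$; $L^\infty(\mu,Lip_0(\mathbb R))$ is defined analogously with $L^\infty(\mu)$. A map $T:X(\mu)\to Y(\mu)$ is strongly lattice Lipschitz if there is $\Phi\in\mathcal M(X,Y)(\mu,Lip_0(\mathbb R))$ such that for all $f\in X(\mu)$, $T(f)(w)=\Phi(w)(f(w))$ for $\mu$-a.e. $w$. *)

theory Defs
  imports "HOL-Analysis.Analysis"
begin

section \<open>The Banach space of real Lipschitz functions vanishing at 0\<close>

typedef lip0 = "{\<phi> :: real \<Rightarrow> real. \<phi> 0 = 0 \<and> (\<exists>L. L-lipschitz_on UNIV \<phi>)}"
  morphisms lip0_apply Abs_lip0
  by (intro exI[of _ "\<lambda>_. 0"]) (auto simp: lipschitz_on_def)

setup_lifting type_definition_lip0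

lemma lip0_lipschitz_ex: "\<exists>L. L-lipschitz_on UNIV (lip0_apply \<phi>)"
  using lip0_apply[of \<phi>] by simp

lemma lip0_zero [simp]: "lip0_apply \<phi> 0 = 0"
  using lip0_apply[of \<phi>] by simp

lemma lip0_eqI: "(\<And>x. lip0_apply \<phi> x = lip0_apply \<psi> x) \<Longrightarrow> \<phi> = \<psi>"
  by (metis lip0_apply_inject ext)

instantiation lip0 :: real_vector
begin

lift_definition zero_lip0 :: lip0 is "\<lambda>_. 0"
  by (auto simp: lipschitz_on_def)

lift_definition plus_lip0 :: "lip0 \<Rightarrow> lip0 \<Rightarrow> lip0" is "\<lambda>\<phi> \<psi> x. \<phi> x + \<psi> x"
  by (auto intro: lipschitz_on_add)

lift_definition minus_lip0 :: "lip0 \<Rightarrow> lip0 \<Rightarrow> lip0" is "\<lambda>\<phi> \<psi> x. \<phi> x - \<psi> x"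
  by (auto intro: lipschitz_on_diff)

lift_definition uminus_lip0 :: "lip0 \<Rightarrow> lip0" is "\<lambda>\<phi> x. - \<phi> x"
  by (auto intro: lipschitz_on_minus)

lift_definition scaleR_lip0 :: "real \<Rightarrow> lip0 \<Rightarrow> lip0" is "\<lambda>c \<phi> x. c * \<phi> x"
  by (auto intro: lipschitz_on_cmult_real)

lemmas lip0_apply_simps [simp] =
  zero_lip0.rep_eq plus_lip0.rep_eq minus_lip0.rep_eq uminus_lip0.rep_eq scaleR_lip0.rep_eq

instance
  by standard (auto intro!: lip0_eqI simp: algebra_simps)

end

definition lip_const :: "(real \<Rightarrow> real) \<Rightarrow> real" where
  "lip_const \<phi> = Inf {L. L-lipschitz_on UNIV \<phi>}"

lemma lip_const_le: "L-lipschitz_on UNIV \<phi> \<Longrightarrow> lip_const \<phi> \<le> L"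
  unfolding lip_const_def
  by (rule cInf_lower) (auto intro!: bdd_belowI[of _ 0] simp: lipschitz_on_def)

lemma lip_const_lipschitz_on:
  assumes "L-lipschitz_on UNIV \<phi>"
  shows "(lip_const \<phi>)-lipschitz_on UNIV \<phi>"
proof (rule lipschitz_onI)
  let ?S = "{L. L-lipschitz_on UNIV \<phi>}"
  have ne: "?S \<noteq> {}" using assms by auto
  show "0 \<le> lip_const \<phi>"
    unfolding lip_const_def by (rule cInf_greatest[OF ne]) (auto simp: lipschitz_on_def)
  show "dist (\<phi> x) (\<phi> y) \<le> lip_const \<phi> * dist x y" for x y
  proof (cases "x = y")
    case False
    have "dist (\<phi> x) (\<phi> y) / dist x y \<le> lip_const \<phi>"
      unfolding lip_const_def
    proof (rule cInf_greatest[OF ne])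
      fix K assume "K \<in> ?S"
      then have "dist (\<phi> x) (\<phi> y) \<le> K * dist x y" by (auto simp: lipschitz_on_def)
      then show "dist (\<phi> x) (\<phi> y) / dist x y \<le> K" using False by (simp add: divide_le_eq)
    qed
    then show ?thesis using False by (simp add: divide_le_eq)
  qed simp
qed

instantiation lip0 :: real_normed_vector
begin

definition norm_lip0 :: "lip0 \<Rightarrow> real" where "norm_lip0 \<phi> = lip_const (lip0_apply \<phi>)"
definition dist_lip0 :: "lip0 \<Rightarrow> lip0 \<Rightarrow> real" where "dist_lip0 \<phi> \<psi> = norm (\<phi> - \<psi>)"
definition sgn_lip0 :: "lip0 \<Rightarrow> lip0" where "sgn_lip0 \<phi> = \<phi> /\<^sub>R norm \<phi>"
definition uniformity_lip0 :: "(lip0 \<times> lip0) filter" where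
  "uniformity_lip0 = (INF e\<in>{0 <..}. principal {(\<phi>, \<psi>). dist \<phi> \<psi> < e})"
definition open_lip0 :: "lip0 set \<Rightarrow> bool" where
  "open_lip0 U = (\<forall>\<phi>\<in>U. \<forall>\<^sub>F (\<phi>', \<psi>) in uniformity. \<phi>' = \<phi> \<longrightarrow> \<psi> \<in> U)"

lemma lip0_lipschitz_norm: "(norm \<phi>)-lipschitz_on UNIV (lip0_apply \<phi>)" for \<phi> :: lip0
  using lip0_lipschitz_ex[of \<phi>] lip_const_lipschitz_on by (auto simp: norm_lip0_def)

lemma lip0_norm_le: "L-lipschitz_on UNIV (lip0_apply \<phi>) \<Longrightarrow> norm \<phi> \<le> L" for \<phi> :: lip0
  by (simp add: norm_lip0_def lip_const_le)

lemma lip0_norm_nonneg: "0 \<le> norm \<phi>" for \<phi> :: lip0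
  using lip0_lipschitz_norm lipschitz_on_nonneg by blast

lemma lip0_scaleR_norm_le: "norm (c *\<^sub>R \<phi>) \<le> \<bar>c\<bar> * norm \<phi>" for \<phi> :: lip0
  using lipschitz_on_cmult_real[OF lip0_lipschitz_norm, of c \<phi>] by (intro lip0_norm_le) simp

instance
proof
  fix \<phi> \<psi> :: lip0 and c :: real
  show "norm \<phi> = 0 \<longleftrightarrow> \<phi> = 0"
  proof
    assume "norm \<phi> = 0"
    then have "lip0_apply \<phi> x = 0" for x
      using lipschitz_onD[OF lip0_lipschitz_norm[of \<phi>], of x 0] by simp
    then show "\<phi> = 0" by (auto intro: lip0_eqI)
  next
    assume "\<phi> = 0"
    then have "norm \<phi> \<le> 0" by (intro lip0_norm_le) (auto simp: lipschitz_on_def)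
    then show "norm \<phi> = 0" using lip0_norm_nonneg[of \<phi>] by simp
  qed
  show "norm (\<phi> + \<psi>) \<le> norm \<phi> + norm \<psi>"
    using lipschitz_on_add[OF lip0_lipschitz_norm[of \<phi>] lip0_lipschitz_norm[of \<psi>]]
    by (intro lip0_norm_le) simp
  show "norm (c *\<^sub>R \<phi>) = \<bar>c\<bar> * norm \<phi>"
  proof (cases "c = 0")
    case True
    then show ?thesis
      using lip0_scaleR_norm_le[of c \<phi>] lip0_norm_nonneg[of "c *\<^sub>R \<phi>"] by simp
  next
    case False
    have "norm \<phi> \<le> \<bar>inverse c\<bar> * norm (c *\<^sub>R \<phi>)"
      using lip0_scaleR_norm_le[of "inverse c" "c *\<^sub>R \<phi>"] False by simp
    then have "\<bar>c\<bar> * norm \<phi> \<le> norm (c *\<^sub>R \<phi>)"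
      using False by (simp add: field_simps)
    then show ?thesis using lip0_scaleR_norm_le[of c \<phi>] by simp
  qed
qed (auto simp: dist_lip0_def sgn_lip0_def uniformity_lip0_def open_lip0_def)

end

lemma lip0_abs_le: "\<bar>lip0_apply \<phi> x\<bar> \<le> norm \<phi> * \<bar>x\<bar>"
  using lipschitz_onD[OF lip0_lipschitz_norm[of \<phi>], of x 0] by (simp add: dist_real_def)

instance lip0 :: banach
proof
  fix u :: "nat \<Rightarrow> lip0"
  assume C: "Cauchy u"
  have "Cauchy (\<lambda>n. lip0_apply (u n) x)" for x
  proof (rule metric_CauchyI)
    fix e :: real assume "0 < e"
    then have "0 < e / (\<bar>x\<bar> + 1)" by simp
    then obtain N where N: "\<forall>m\<ge>N. \<forall>n\<ge>N. dist (u m) (u n) < e / (\<bar>x\<bar> + 1)"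
      using metric_CauchyD[OF C] by blast
    have "dist (lip0_apply (u m) x) (lip0_apply (u n) x) < e" if "m \<ge> N" "n \<ge> N" for m n
    proof -
      have "dist (lip0_apply (u m) x) (lip0_apply (u n) x) \<le> norm (u m - u n) * \<bar>x\<bar>"
        using lip0_abs_le[of "u m - u n" x] by (simp add: dist_real_def)
      also have "\<dots> \<le> norm (u m - u n) * (\<bar>x\<bar> + 1)" by (simp add: mult_left_mono)
      also have "\<dots> < e" using N that by (simp add: dist_norm pos_less_divide_eq)
      finally show ?thesis .
    qed
    then show "\<exists>N. \<forall>m\<ge>N. \<forall>n\<ge>N. dist (lip0_apply (u m) x) (lip0_apply (u n) x) < e" by blast
  qed
  then have "\<exists>l. (\<lambda>n. lip0_apply (u n) x) \<longlonglongrightarrow> l" for x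
    by (simp add: Cauchy_convergent_iff convergent_def)
  then obtain g where g: "\<And>x. (\<lambda>n. lip0_apply (u n) x) \<longlonglongrightarrow> g x" by metis
  have close: "e-lipschitz_on UNIV (\<lambda>x. lip0_apply (u m) x - g x)"
    if e: "0 \<le> e" and N: "\<forall>n\<ge>N. norm (u m - u n) \<le> e" for e m N
  proof (rule lipschitz_onI[OF _ e])
    fix x y :: real
    have "(\<lambda>n. dist (lip0_apply (u m - u n) x) (lip0_apply (u m - u n) y))
        \<longlonglongrightarrow> dist (lip0_apply (u m) x - g x) (lip0_apply (u m) y - g y)"
      by (auto intro!: tendsto_intros g)
    moreover have "dist (lip0_apply (u m - u n) x) (lip0_apply (u m - u n) y) \<le> e * dist x y"
      if "n \<ge> N" for n
      using lipschitz_on_le[OF lip0_lipschitz_norm[of "u m - u n"]] N that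
      by (auto dest: lipschitz_onD)
    ultimately show "dist (lip0_apply (u m) x - g x) (lip0_apply (u m) y - g y) \<le> e * dist x y"
      by (auto intro: LIMSEQ_le_const2)
  qed
  have Cd: "\<exists>N. \<forall>m\<ge>N. \<forall>n\<ge>N. norm (u m - u n) \<le> e" if "0 < e" for e
    using metric_CauchyD[OF C that] by (metis dist_norm less_imp_le)
  obtain N where N: "\<forall>m\<ge>N. \<forall>n\<ge>N. norm (u m - u n) \<le> 1" using Cd[of 1] by auto
  have "1-lipschitz_on UNIV (\<lambda>x. lip0_apply (u N) x - g x)" using N by (intro close) auto
  from lipschitz_on_diff[OF lip0_lipschitz_norm[of "u N"] this]
  have "\<exists>L. L-lipschitz_on UNIV g" by auto
  moreover have "g 0 = 0" using LIMSEQ_unique[OF g[of 0]] by simp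
  ultimately have g_eq: "lip0_apply (Abs_lip0 g) = g" by (simp add: Abs_lip0_inverse)
  have "u \<longlonglongrightarrow> Abs_lip0 g"
  proof (rule metric_LIMSEQ_I)
    fix e :: real assume "0 < e"
    then obtain N where N: "\<forall>m\<ge>N. \<forall>n\<ge>N. norm (u m - u n) \<le> e / 2" using Cd[of "e/2"] by auto
    have "dist (u m) (Abs_lip0 g) < e" if "m \<ge> N" for m
    proof -
      have "norm (u m - Abs_lip0 g) \<le> e / 2"
        using close[of "e/2" N m] N that \<open>0 < e\<close> by (intro lip0_norm_le) (simp add: g_eq)
      then show ?thesis using \<open>0 < e\<close> by (simp add: dist_norm)
    qed
    then show "\<exists>N. \<forall>n\<ge>N. dist (u n) (Abs_lip0 g) < e" by blast
  qed
  then show "convergent u" by (auto simp: convergent_def)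
qed

lifting_update lip0.lifting
lifting_forget lip0.lifting


section \<open>Banach function spaces\<close>

text \<open>
  Classes of measurable functions are handled through their representatives: a space of classes
  is a set \<open>X\<close> of measurable functions that contains with a function everything a.e. equal to it
  (this is the case \<open>|f| = |g|\<close> of the ideal property below), and its norm is a function \<open>N\<close> on
  representatives, which depends only on the class because of monotonicity. Only the values of
  \<open>N\<close> on \<open>X\<close> are relevant.
\<close>

locale banach_function_space =
  fixes M :: "'a measure" and X :: "('a \<Rightarrow> real) set" and N :: "('a \<Rightarrow> real) \<Rightarrow> real"
  assumes measurable: "X \<subseteq> borel_measurable M"
    and add_closed: "f \<in> X \<Longrightarrow> g \<in> X \<Longrightarrow> (\<lambda>w. f w + g w) \<in> X"
    and scale_closed: "f \<in> X \<Longrightarrow> (\<lambda>w. c * f w) \<in> X"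
    and ideal: "g \<in> X \<Longrightarrow> f \<in> borel_measurable M \<Longrightarrow> AE w in M. \<bar>f w\<bar> \<le> \<bar>g w\<bar> \<Longrightarrow> f \<in> X"
    and indicator_mem: "indicator (space M) \<in> X"
    and norm_nonneg: "f \<in> X \<Longrightarrow> 0 \<le> N f"
    and norm_eq_0_iff: "f \<in> X \<Longrightarrow> N f = 0 \<longleftrightarrow> (AE w in M. f w = 0)"
    and norm_scale: "f \<in> X \<Longrightarrow> N (\<lambda>w. c * f w) = \<bar>c\<bar> * N f"
    and norm_triangle: "f \<in> X \<Longrightarrow> g \<in> X \<Longrightarrow> N (\<lambda>w. f w + g w) \<le> N f + N g"
    and norm_mono: "f \<in> X \<Longrightarrow> g \<in> X \<Longrightarrow> AE w in M. \<bar>f w\<bar> \<le> \<bar>g w\<bar> \<Longrightarrow> N f \<le> N g"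
    and norm_complete:
      "(\<And>n. u n \<in> X) \<Longrightarrow>
       (\<And>e. e > 0 \<Longrightarrow> \<exists>K. \<forall>m\<ge>K. \<forall>n\<ge>K. N (\<lambda>w. u m w - u n w) < e) \<Longrightarrow>
       \<exists>f\<in>X. (\<lambda>n. N (\<lambda>w. u n w - f w)) \<longlonglongrightarrow> 0"

definition fatou_property ::
  "'a measure \<Rightarrow> ('a \<Rightarrow> real) set \<Rightarrow> (('a \<Rightarrow> real) \<Rightarrow> real) \<Rightarrow> bool" where
  "fatou_property M Y N \<longleftrightarrow>
    (\<forall>u f. (\<forall>n. u n \<in> Y) \<and> (\<forall>n. AE w in M. u n w \<le> u (Suc n) w) \<and> (\<exists>C. \<forall>n. N (u n) \<le> C) \<and>
       f \<in> borel_measurable M \<and> (AE w in M. (\<lambda>n. u n w) \<longlonglongrightarrow> f w) \<longrightarrow> f \<in> Y)"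

definition multipliers :: "'a measure \<Rightarrow> ('a \<Rightarrow> real) set \<Rightarrow> ('a \<Rightarrow> real) set \<Rightarrow> ('a \<Rightarrow> real) set" where
  "multipliers M X Y = {h \<in> borel_measurable M. \<forall>f\<in>X. (\<lambda>w. h w * f w) \<in> Y}"

text \<open>
  Operator norm of the multiplication operator \<open>f \<mapsto> h f\<close>, as an extended nonnegative number so
  that the supremum is never taken over an unbounded set of reals.
\<close>

definition multiplier_norm ::
  "('a \<Rightarrow> real) set \<Rightarrow> (('a \<Rightarrow> real) \<Rightarrow> real) \<Rightarrow> (('a \<Rightarrow> real) \<Rightarrow> real) \<Rightarrow> ('a \<Rightarrow> real) \<Rightarrow> ennreal" where
  "multiplier_norm X NX NY h = (SUP f\<in>{f \<in> X. NX f \<le> 1}. ennreal (NY (\<lambda>w. h w * f w)))"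

definition Linfty :: "'a measure \<Rightarrow> ('a \<Rightarrow> real) set" where
  "Linfty M = {h \<in> borel_measurable M. \<exists>C. AE w in M. \<bar>h w\<bar> \<le> C}"


section \<open>Strongly lattice Lipschitz operators\<close>

definition strongly_measurable :: "'a measure \<Rightarrow> ('a \<Rightarrow> 'e::banach) \<Rightarrow> bool" where
  "strongly_measurable M \<Psi> \<longleftrightarrow>
    (\<exists>s. (\<forall>n. simple_function M (s n)) \<and> (AE w in M. (\<lambda>n. s n w) \<longlonglongrightarrow> \<Psi> w))"

text \<open>
  For a function space \<open>S\<close>, the vector valued space \<open>S(\<mu>, E)\<close>; it is used below with
  \<open>S = multipliers M X Y\<close> and \<open>S = Linfty M\<close>.
\<close>

definition vector_valued :: "'a measure \<Rightarrow> ('a \<Rightarrow> real) set \<Rightarrow> ('a \<Rightarrow> 'e::banach) set" where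
  "vector_valued M S = {\<Psi>. strongly_measurable M \<Psi> \<and> (\<lambda>w. norm (\<Psi> w)) \<in> S}"

definition operator_between ::
  "'a measure \<Rightarrow> ('a \<Rightarrow> real) set \<Rightarrow> ('a \<Rightarrow> real) set \<Rightarrow> (('a \<Rightarrow> real) \<Rightarrow> 'a \<Rightarrow> real) \<Rightarrow> bool" where
  "operator_between M X Y T \<longleftrightarrow>
    (\<forall>f\<in>X. T f \<in> Y) \<and>
    (\<forall>f\<in>X. \<forall>g\<in>X. (AE w in M. f w = g w) \<longrightarrow> (AE w in M. T f w = T g w))"

definition represented_by ::
  "'a measure \<Rightarrow> ('a \<Rightarrow> real) set \<Rightarrow> (('a \<Rightarrow> real) \<Rightarrow> 'a \<Rightarrow> real) \<Rightarrow> ('a \<Rightarrow> lip0) \<Rightarrow> bool" where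
  "represented_by M X T \<Phi> \<longleftrightarrow> (\<forall>f\<in>X. AE w in M. T f w = lip0_apply (\<Phi> w) (f w))"

definition strongly_lattice_lipschitz ::
  "'a measure \<Rightarrow> ('a \<Rightarrow> real) set \<Rightarrow> ('a \<Rightarrow> real) set \<Rightarrow> (('a \<Rightarrow> real) \<Rightarrow> 'a \<Rightarrow> real) \<Rightarrow> bool" where
  "strongly_lattice_lipschitz M X Y T \<longleftrightarrow>
    (\<exists>\<Phi>\<in>vector_valued M (multipliers M X Y). represented_by M X T \<Phi>)"

end

theory Submission
  imports Defs
begin

text \<open>
  A representing function is determined a.e. by the values of the operator on rational constants,
  so the assertions about every representation reduce to those about one.

  If \<open>\<Phi>\<close> represents \<open>T\<close> with Lipschitz constants in \<open>\<M>(X,Y)\<close>, the truncations of \<open>\<Phi>\<close> to the sets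
  where its norm is at most \<open>n\<close> are bounded, converge pointwise, and are dominated by \<open>\<Phi>\<close>.
  The norm of \<open>Y\<close> need not be continuous along increasing sequences (the Fatou property only
  concerns membership), so the truncations may miss the supremum; a.e. convergence does not see the
  first term of the sequence, which is replaced by a constant function having the multiplier norm
  of \<open>\<Phi>\<close>.

  Conversely, the infima of the tails of the norms of the approximants increase to the norm of
  \<open>\<Phi>\<close>, and the Fatou property applies to their products with \<open>\<bar>f\<bar>\<close>.
\<close>

section \<open>Measurability under a complete measure, and strong measurability\<close>

lemma (in complete_measure) borel_measurable_AE_eq:
  fixes f g :: "'a \<Rightarrow> real"
  assumes g: "g \<in> borel_measurable M" and eq: "AE w in M. f w = g w"
  shows "f \<in> borel_measurable M"
proof (rule measurableI)
  fix S :: "real set" assume "S \<in> sets borel"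
  with g have B: "g -` S \<inter> space M \<in> sets M" by (rule measurable_sets)
  \<comment> \<open>The two preimages differ inside a null set, so completeness makes the second one
    measurable.\<close>
  have "AE w in M. w \<in> g -` S \<inter> space M \<longleftrightarrow> w \<in> f -` S \<inter> space M"
    using eq by eventually_elim simp
  from in_sets_AE[OF this B] show "f -` S \<inter> space M \<in> sets M" by simp
qed simp

lemma (in complete_measure) strongly_measurable_norm:
  assumes "strongly_measurable M \<Psi>"
  shows "(\<lambda>w. norm (\<Psi> w)) \<in> borel_measurable M"
proof -
  obtain s where s: "\<And>n. simple_function M (s n)" "AE w in M. (\<lambda>n. s n w) \<longlonglongrightarrow> \<Psi> w"
    using assms by (auto simp: strongly_measurable_def)
  have "(\<lambda>w. norm (s n w)) \<in> borel_measurable M" for n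
    by (intro borel_measurable_simple_function simple_function_compose1[OF s(1)])
  \<comment> \<open>\<open>lim\<close> is total and measurable without any convergence; its values
    where the sequence diverges are confined to a null set.\<close>
  then have "(\<lambda>w. lim (\<lambda>n. norm (s n w))) \<in> borel_measurable M"
    by (rule borel_measurable_lim_metric)
  moreover have "AE w in M. norm (\<Psi> w) = lim (\<lambda>n. norm (s n w))"
    using s(2) by eventually_elim (metis limI tendsto_norm)
  ultimately show ?thesis by (rule borel_measurable_AE_eq)
qed

lemma const_mem_Linfty: "(\<lambda>_. c) \<in> Linfty M"
  by (auto simp: Linfty_def)

lemma strongly_measurable_const: "strongly_measurable M (\<lambda>_. x)"
  unfolding strongly_measurable_def by (intro exI[of _ "\<lambda>_ _. x"]) simp

lemma strongly_measurable_indicator_scaleR: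
  assumes "strongly_measurable M \<Psi>" and "A \<in> sets M"
  shows "strongly_measurable M (\<lambda>w. indicator A w *\<^sub>R \<Psi> w)"
proof -
  obtain s where s: "\<And>n. simple_function M (s n)" "AE w in M. (\<lambda>n. s n w) \<longlonglongrightarrow> \<Psi> w"
    using assms by (auto simp: strongly_measurable_def)
  have "simple_function M (\<lambda>w. (indicator A w :: real) *\<^sub>R s n w)" for n
    using simple_function_compose2[OF simple_function_indicator[OF assms(2)] s(1)] .
  moreover have "AE w in M. (\<lambda>n. (indicator A w :: real) *\<^sub>R s n w) \<longlonglongrightarrow> indicator A w *\<^sub>R \<Psi> w"
    using s(2) by eventually_elim (intro tendsto_intros)
  ultimately show ?thesis
    unfolding strongly_measurable_def
    by (intro exI[of _ "\<lambda>n w. (indicator A w :: real) *\<^sub>R s n w"] conjI allI)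
qed

section \<open>Lipschitz functions: separation by rational points, a unit vector\<close>

lemma lip0_eq_if_eq_on_Rats:
  assumes "\<And>q. lip0_apply \<phi> (of_rat q) = lip0_apply \<psi> (of_rat q)"
  shows "\<phi> = \<psi>"
proof (rule lip0_eqI)
  fix x
  have "lip0_apply (\<phi> - \<psi>) x = 0"
  proof (rule continuous_constant_on_closure[where S = \<rat> and f = "lip0_apply (\<phi> - \<psi>)"])
    show "continuous_on (closure \<rat>) (lip0_apply (\<phi> - \<psi>))"
      using lipschitz_on_continuous_on[OF lip0_lipschitz_norm] continuous_on_subset by blast
  qed (use assms in \<open>auto elim!: Rats_cases simp: Rats_closure_real\<close>)
  then show "lip0_apply \<phi> x = lip0_apply \<psi> x" by simp
qed

text \<open>The identity has Lipschitz constant 1, the lower bound coming from its value at 1. Its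
  multiples turn a nonnegative scalar into a Lipschitz function of that norm.\<close>

lemma lip0_norm_one_ex: "\<exists>\<iota> :: lip0. norm \<iota> = 1"
proof
  let ?\<iota> = "Abs_lip0 (\<lambda>x. x)"
  have L: "1-lipschitz_on UNIV (\<lambda>x :: real. x)" by (simp add: lipschitz_on_def)
  then have eq: "lip0_apply ?\<iota> = (\<lambda>x. x)" by (intro Abs_lip0_inverse) auto
  show "norm ?\<iota> = 1"
    using lip0_norm_le[of 1 ?\<iota>] L lip0_abs_le[of ?\<iota> 1] by (simp add: eq)
qed

section \<open>Order and completeness in a Banach function space\<close>

context banach_function_space
begin

lemma const_mem: "(\<lambda>_. c) \<in> X"
  \<comment> \<open>The scaled indicator is constant only on \<open>space M\<close>; the ideal
    property disposes of the values elsewhere.\<close>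
  using scale_closed[OF indicator_mem, of c] by (rule ideal) auto

lemma diff_closed: "f \<in> X \<Longrightarrow> g \<in> X \<Longrightarrow> (\<lambda>w. f w - g w) \<in> X"
  using add_closed[OF _ scale_closed[of g "-1"]] by simp

lemma abs_closed: "f \<in> X \<Longrightarrow> (\<lambda>w. \<bar>f w\<bar>) \<in> X"
  using measurable by (auto intro!: ideal[of f "\<lambda>w. \<bar>f w\<bar>"])

lemma norm_abs_cong: "f \<in> X \<Longrightarrow> g \<in> X \<Longrightarrow> AE w in M. \<bar>f w\<bar> = \<bar>g w\<bar> \<Longrightarrow> N f = N g"
  by (intro antisym norm_mono) auto

lemma norm_minus_commute: "f \<in> X \<Longrightarrow> g \<in> X \<Longrightarrow> N (\<lambda>w. f w - g w) = N (\<lambda>w. g w - f w)"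
  by (intro norm_abs_cong diff_closed) (auto simp: abs_minus_commute)

lemma Linfty_mult_closed:
  assumes h: "h \<in> Linfty M" and f: "f \<in> X"
  shows "(\<lambda>w. h w * f w) \<in> X"
proof -
  obtain C where C: "AE w in M. \<bar>h w\<bar> \<le> C" and [measurable]: "h \<in> borel_measurable M"
    using h by (auto simp: Linfty_def)
  have [measurable]: "f \<in> borel_measurable M" using f measurable by auto
  have "AE w in M. \<bar>h w * f w\<bar> \<le> \<bar>C * f w\<bar>"
    using C by eventually_elim (auto simp: abs_mult intro!: mult_right_mono)
  then show ?thesis using ideal[OF scale_closed[OF f]] by simp
qed

text \<open>The positive part of \<open>u n - g\<close> is dominated by the absolute value of
  \<open>u m - g\<close> for every \<open>m\<close> from \<open>n\<close> on, so its norm is bounded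
  by a null sequence. No a.e. convergent subsequence has to be extracted.\<close>

lemma le_norm_limit_incseq:
  assumes u: "\<And>n. u n \<in> X" and inc: "\<And>w. incseq (\<lambda>n. u n w)"
    and g: "g \<in> X" and lim: "(\<lambda>n. N (\<lambda>w. u n w - g w)) \<longlonglongrightarrow> 0"
  shows "AE w in M. u n w \<le> g w"
proof -
  let ?p = "\<lambda>w. max 0 (u n w - g w)"
  have [measurable]: "u n \<in> borel_measurable M" "g \<in> borel_measurable M"
    using u g measurable by auto
  have p: "?p \<in> X" by (rule ideal[OF diff_closed[OF u[of n] g]]) auto
  have "N ?p \<le> N (\<lambda>w. u m w - g w)" if "m \<ge> n" for m
  proof (intro norm_mono p diff_closed u g AE_I2)
    fix w
    show "\<bar>?p w\<bar> \<le> \<bar>u m w - g w\<bar>" using incseqD[OF inc that, of w] by (auto simp: max_def)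
  qed
  then have "N ?p \<le> 0" by (intro LIMSEQ_le_const[OF lim]) blast
  then have "AE w in M. ?p w = 0" using norm_eq_0_iff[OF p] norm_nonneg[OF p] by simp
  then show ?thesis by eventually_elim (simp add: max_def split: if_splits)
qed

text \<open>The series of the functions \<open>(1/2) ^ n * \<bar>u n w\<bar>\<close> is Cauchy in
  norm, and by completeness its sum \<open>g\<close> exists; as the terms are nonnegative,
  \<open>g\<close> dominates each of them a.e.\<close>

lemma dominating_ex:
  assumes u: "\<And>n. u n \<in> X" "\<And>n. N (u n) \<le> 1"
  obtains g where "g \<in> X" "\<And>n. AE w in M. \<bar>u n w\<bar> \<le> 2 ^ n * g w"
proof -
  define v where "v n w = (1/2) ^ n * \<bar>u n w\<bar>" for n w
  define x where "x n w = (\<Sum>k<n. v k w)" for n w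
  have v: "v n \<in> X" for n
    unfolding v_def by (intro scale_closed abs_closed u)
  have Nv: "N (v n) \<le> (1/2) ^ n" for n
  proof -
    have "N (v n) = (1/2) ^ n * N (\<lambda>w. \<bar>u n w\<bar>)"
      unfolding v_def by (subst norm_scale) (auto intro: abs_closed u)
    also have "N (\<lambda>w. \<bar>u n w\<bar>) = N (u n)" by (intro norm_abs_cong abs_closed u) auto
    finally show ?thesis using mult_left_mono[OF u(2)[of n], of "(1/2) ^ n"] by simp
  qed
  have x: "x n \<in> X" for n
  proof (induction n)
    case 0
    then show ?case using const_mem[of 0] by (simp add: x_def[abs_def])
  next
    case (Suc n)
    then show ?case using add_closed[OF Suc v[of n]] by (simp add: x_def[abs_def])
  qed
  \<comment> \<open>The bound is the geometric sum of \<open>(1/2) ^ k\<close> over \<open>k\<close>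
    from \<open>n\<close> up to, but excluding, \<open>n + d\<close>.\<close>
  have step: "N (\<lambda>w. x (n + d) w - x n w) \<le> 2 * (1/2) ^ n - 2 * (1/2) ^ (n + d)" for n d
  proof (induction d)
    case 0
    show ?case using norm_eq_0_iff[OF const_mem[of 0]] by simp
  next
    case (Suc d)
    have "N (\<lambda>w. x (n + Suc d) w - x n w) = N (\<lambda>w. (x (n + d) w - x n w) + v (n + d) w)"
      by (simp add: x_def algebra_simps)
    also have "\<dots> \<le> N (\<lambda>w. x (n + d) w - x n w) + N (v (n + d))"
      by (intro norm_triangle diff_closed x v)
    also have "\<dots> \<le> 2 * (1/2) ^ n - 2 * (1/2) ^ (n + d) + (1/2) ^ (n + d)"
      by (intro add_mono Suc Nv)
    finally show ?case by simp
  qed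
  have le: "N (\<lambda>w. x m w - x n w) \<le> 2 * (1/2) ^ n" if "n \<le> m" for m n
    using step[of n "m - n"] that zero_le_power[of "1/2 :: real" m]
    by (simp del: zero_le_power)
  have "\<exists>K. \<forall>m\<ge>K. \<forall>n\<ge>K. N (\<lambda>w. x m w - x n w) < e" if e: "e > 0" for e
  proof -
    obtain K where K: "(1/2 :: real) ^ K < e / 2"
      using real_arch_pow_inv[of "e/2" "1/2"] e by auto
    have "N (\<lambda>w. x m w - x n w) < e" if "m \<ge> K" "n \<ge> K" for m n
    proof -
      have "N (\<lambda>w. x m w - x n w) \<le> 2 * (1/2) ^ min m n"
        using le[of n m] le[of m n] norm_minus_commute[OF x[of m] x[of n]]
        by (cases "n \<le> m") (simp_all add: min_def)
      also have "\<dots> \<le> 2 * (1/2) ^ K" using that by (auto intro!: power_decreasing)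
      finally show ?thesis using K by simp
    qed
    then show ?thesis by blast
  qed
  from norm_complete[of x, OF x this]
  obtain g where g: "g \<in> X" "(\<lambda>n. N (\<lambda>w. x n w - g w)) \<longlonglongrightarrow> 0" by auto
  have v0: "0 \<le> v n w" for n w by (simp add: v_def)
  have "incseq (\<lambda>n. x n w)" for w by (rule incseq_SucI) (simp add: x_def v0)
  then have xg: "AE w in M. x n w \<le> g w" for n by (rule le_norm_limit_incseq[OF x _ g])
  have "AE w in M. \<bar>u n w\<bar> \<le> 2 ^ n * g w" for n
    \<comment> \<open>The partial sum \<open>x n\<close> stops before the term \<open>v n\<close>;
      the next one contains it.\<close>
    using xg[of "Suc n"]
  proof eventually_elim
    case (elim w)
    have "v n w \<le> g w" using elim sum_nonneg[of "{..<n}" "\<lambda>k. v k w"] v0 by (simp add: x_def)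
    then show ?case by (simp add: v_def field_simps)
  qed
  with g(1) show thesis by (rule that)
qed

end

section \<open>Uniqueness of the representing function\<close>

lemma representation_unique:
  assumes "banach_function_space M X N" "represented_by M X T \<Phi>" "represented_by M X T \<Psi>"
  shows "AE w in M. \<Phi> w = \<Psi> w"
proof -
  interpret banach_function_space M X N by fact
  have "AE w in M. lip0_apply (\<Phi> w) (of_rat q) = lip0_apply (\<Psi> w) (of_rat q)" for q
  proof -
    have "AE w in M. T (\<lambda>_. of_rat q) w = lip0_apply (\<Phi> w) (of_rat q)"
      and "AE w in M. T (\<lambda>_. of_rat q) w = lip0_apply (\<Psi> w) (of_rat q)"
      using assms(2,3) const_mem[of "of_rat q"] by (auto simp: represented_by_def)
    then show ?thesis by eventually_elim simp
  qed
  \<comment> \<open>The exceptional null set depends on \<open>q\<close>; there are only countably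
    many of them.\<close>
  then have "AE w in M. \<forall>q. lip0_apply (\<Phi> w) (of_rat q) = lip0_apply (\<Psi> w) (of_rat q)"
    by (simp add: AE_all_countable)
  then show ?thesis by eventually_elim (auto intro: lip0_eq_if_eq_on_Rats)
qed

section \<open>Multipliers between two Banach function spaces\<close>

locale banach_function_space_pair =
  X: banach_function_space M X NX + Y: banach_function_space M Y NY
  for M :: "'a measure" and X NX Y NY
begin

lemma multipliersI_AE_le:
  assumes "h \<in> multipliers M X Y" "k \<in> borel_measurable M" "AE w in M. \<bar>k w\<bar> \<le> \<bar>h w\<bar>"
  shows "k \<in> multipliers M X Y"
proof -
  have "(\<lambda>w. k w * f w) \<in> Y" if "f \<in> X" for f
  proof (rule Y.ideal)
    show "(\<lambda>w. h w * f w) \<in> Y" using assms(1) that by (simp add: multipliers_def)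
    show "(\<lambda>w. k w * f w) \<in> borel_measurable M" using assms(2) that X.measurable by auto
    show "AE w in M. \<bar>k w * f w\<bar> \<le> \<bar>h w * f w\<bar>"
      using assms(3) by eventually_elim (auto simp: abs_mult intro!: mult_right_mono)
  qed
  then show ?thesis using assms(2) by (simp add: multipliers_def)
qed

lemma multiplier_norm_mono:
  assumes "k \<in> multipliers M X Y" "h \<in> multipliers M X Y" "AE w in M. \<bar>k w\<bar> \<le> \<bar>h w\<bar>"
  shows "multiplier_norm X NX NY k \<le> multiplier_norm X NX NY h"
  unfolding multiplier_norm_def
proof (rule SUP_mono)
  fix f assume f: "f \<in> {f \<in> X. NX f \<le> 1}"
  have "NY (\<lambda>w. k w * f w) \<le> NY (\<lambda>w. h w * f w)"
  proof (rule Y.norm_mono)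
    show "AE w in M. \<bar>k w * f w\<bar> \<le> \<bar>h w * f w\<bar>"
      using assms(3) by eventually_elim (auto simp: abs_mult intro!: mult_right_mono)
  qed (use assms f in \<open>auto simp: multipliers_def\<close>)
  then show "\<exists>g\<in>{f \<in> X. NX f \<le> 1}. ennreal (NY (\<lambda>w. k w * f w)) \<le> ennreal (NY (\<lambda>w. h w * g w))"
    using f by (auto intro!: ennreal_leI)
qed

text \<open>
  Unboundedness would be witnessed by unit vectors whose images grow like \<open>4 ^ n\<close>; their images
  are dominated by \<open>2 ^ n\<close> times a single element of \<open>Y\<close>.
\<close>

lemma multiplier_norm_finite:
  assumes h: "h \<in> multipliers M X Y"
  shows "multiplier_norm X NX NY h < \<infinity>"
proof (rule ccontr)
  assume inf: "\<not> ?thesis"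
  have "\<exists>f\<in>X. NX f \<le> 1 \<and> C < NY (\<lambda>w. h w * f w)" for C
  proof (rule ccontr)
    assume "\<not> ?thesis"
    then have "multiplier_norm X NX NY h \<le> ennreal C"
      unfolding multiplier_norm_def by (intro SUP_least ennreal_leI) (simp add: not_less)
    also have "\<dots> < \<infinity>" by simp
    finally show False using inf by simp
  qed
  then have "\<exists>u. \<forall>n :: nat. u n \<in> X \<and> NX (u n) \<le> 1 \<and> 4 ^ n < NY (\<lambda>w. h w * u n w)"
    by (intro choice) blast
  then obtain u where u: "\<And>n :: nat. u n \<in> X" "\<And>n. NX (u n) \<le> 1"
    "\<And>n. 4 ^ n < NY (\<lambda>w. h w * u n w)" by blast
  obtain g where g: "g \<in> X" "\<And>n. AE w in M. \<bar>u n w\<bar> \<le> 2 ^ n * g w"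
    by (rule X.dominating_ex[of u, OF u(1,2)]) blast
  have hf: "(\<lambda>w. h w * f w) \<in> Y" if "f \<in> X" for f using h that by (simp add: multipliers_def)
  have "2 ^ n < NY (\<lambda>w. h w * g w)" for n :: nat
  proof -
    have "(2 :: real) ^ n * 2 ^ n = 4 ^ n" by (simp flip: power_mult_distrib)
    also have "\<dots> < NY (\<lambda>w. h w * u n w)" by (rule u)
    also have "\<dots> \<le> NY (\<lambda>w. 2 ^ n * (h w * g w))"
    proof (intro Y.norm_mono Y.scale_closed hf u g)
      show "AE w in M. \<bar>h w * u n w\<bar> \<le> \<bar>2 ^ n * (h w * g w)\<bar>"
        using g(2)[of n]
      proof eventually_elim
        case (elim w)
        then have "\<bar>u n w\<bar> \<le> \<bar>2 ^ n * g w\<bar>" by linarith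
        then have "\<bar>h w\<bar> * \<bar>u n w\<bar> \<le> \<bar>h w\<bar> * \<bar>2 ^ n * g w\<bar>" by (rule mult_left_mono) simp
        then show ?case by (simp add: abs_mult mult_ac)
      qed
    qed
    also have "\<dots> = 2 ^ n * NY (\<lambda>w. h w * g w)" by (simp add: Y.norm_scale hf g)
    finally show ?thesis by simp
  qed
  moreover obtain n where "NY (\<lambda>w. h w * g w) < 2 ^ n"
    using real_arch_pow[of 2 "NY (\<lambda>w. h w * g w)"] by auto
  ultimately show False by (metis less_asym)
qed

text \<open>The supremum runs over the unit ball only; homogeneity extends the estimate to all of
  \<open>X\<close>. A function of norm 0 cannot be normalized, but it vanishes a.e., and so does its
  product with \<open>h\<close>.\<close>

lemma multiplier_norm_bound:
  assumes h: "h \<in> multipliers M X Y" and C: "multiplier_norm X NX NY h \<le> ennreal C" "0 \<le> C"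
    and f: "f \<in> X"
  shows "NY (\<lambda>w. h w * f w) \<le> C * NX f"
proof (cases "NX f = 0")
  case True
  have hf: "(\<lambda>w. h w * f w) \<in> Y" using h f by (simp add: multipliers_def)
  have "AE w in M. f w = 0" using True X.norm_eq_0_iff[OF f] by simp
  then have "AE w in M. h w * f w = 0" by eventually_elim simp
  then show ?thesis using Y.norm_eq_0_iff[OF hf] True by simp
next
  case False
  then have pos: "NX f > 0" using X.norm_nonneg[OF f] by simp
  let ?g = "\<lambda>w. inverse (NX f) * f w"
  have hf: "(\<lambda>w. h w * f w) \<in> Y" using h f by (simp add: multipliers_def)
  have "?g \<in> X" "NX ?g \<le> 1"
    using pos X.scale_closed[OF f] X.norm_scale[OF f] by auto
  then have "ennreal (NY (\<lambda>w. h w * ?g w)) \<le> multiplier_norm X NX NY h"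
    unfolding multiplier_norm_def by (intro SUP_upper2[of ?g]) auto
  also note C(1)
  finally have "NY (\<lambda>w. h w * ?g w) \<le> C" using C(2) by (simp add: ennreal_le_iff)
  also have "(\<lambda>w. h w * ?g w) = (\<lambda>w. inverse (NX f) * (h w * f w))" by (simp add: mult_ac)
  also have "NY \<dots> = inverse (NX f) * NY (\<lambda>w. h w * f w)"
    using pos by (simp add: Y.norm_scale[OF hf])
  finally show ?thesis using pos by (simp add: field_simps)
qed

text \<open>Multiplication by a bounded function maps \<open>X\<close> into itself, hence into
  \<open>Y\<close>.\<close>

lemma Linfty_subset_multipliers:
  assumes "X \<subseteq> Y"
  shows "Linfty M \<subseteq> multipliers M X Y"
  using X.Linfty_mult_closed assms by (auto simp: multipliers_def Linfty_def)

text \<open>The \<open>h n\<close> need not increase, so the Fatou property does not apply to them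
  directly. Their tail infima \<open>l n\<close> increase, have the same a.e. limit, and inherit the
  bound \<open>C\<close> because \<open>l n\<close> lies below \<open>h n\<close>.\<close>

lemma multipliers_liminf:
  assumes sub: "X \<subseteq> Y" and fatou: "fatou_property M Y NY"
    and h: "\<And>n :: nat. h n \<in> multipliers M X Y" "\<And>n w. 0 \<le> h n w"
    and C: "0 \<le> C" "\<And>n. multiplier_norm X NX NY (h n) \<le> ennreal C"
    and k: "k \<in> borel_measurable M" "AE w in M. (\<lambda>n. h n w) \<longlonglongrightarrow> k w"
  shows "k \<in> multipliers M X Y"
proof -
  define l where "l n w = (INF m\<in>{n..}. h m w)" for n w
  \<comment> \<open>Nonnegativity supplies the lower bound that infima in the reals require.\<close>
  have bdd: "bdd_below ((\<lambda>m. h m w) ` A)" for w A using h(2) by (intro bdd_belowI[of _ 0]) auto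
  have l_le: "l n w \<le> h n w" for n w unfolding l_def by (intro cINF_lower bdd) auto
  have l0: "0 \<le> l n w" for n w unfolding l_def by (intro cINF_greatest h) auto
  have l_mono: "l n w \<le> l (Suc n) w" for n w
    unfolding l_def by (intro cINF_superset_mono bdd) auto
  have l_meas [measurable]: "l n \<in> borel_measurable M" for n
    unfolding l_def using h(1) by (intro borel_measurable_cINF bdd) (auto simp: multipliers_def)
  have l_lim: "(\<lambda>n. l n w) \<longlonglongrightarrow> a" if lim: "(\<lambda>n. h n w) \<longlonglongrightarrow> a" for w a
  proof (rule LIMSEQ_I)
    fix e :: real assume e: "0 < e"
    then obtain K where K: "\<And>n. n \<ge> K \<Longrightarrow> \<bar>h n w - a\<bar> < e / 2"
      using LIMSEQ_D[OF lim, of "e/2"] by auto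
    have "norm (l n w - a) < e" if "n \<ge> K" for n
    proof -
      \<comment> \<open>An infimum of values above \<open>a - e / 2\<close> may equal that number;
        halving \<open>e\<close> keeps the final estimate strict.\<close>
      have "a - e / 2 \<le> h m w" if "m \<ge> n" for m using K[of m] that \<open>n \<ge> K\<close> by linarith
      then have "a - e / 2 \<le> l n w" unfolding l_def by (intro cINF_greatest) auto
      then show ?thesis using l_le[of n w] K[OF that] e unfolding real_norm_def by linarith
    qed
    then show "\<exists>K. \<forall>n\<ge>K. norm (l n w - a) < e" by blast
  qed
  have l: "l n \<in> multipliers M X Y" for n
    using l_le l0 by (intro multipliersI_AE_le[OF h(1)[of n]] l_meas AE_I2) (simp add: h(2))
  have Cl: "multiplier_norm X NX NY (l n) \<le> ennreal C" for n
    using l_le l0 by (intro order.trans[OF multiplier_norm_mono[OF l h(1)[of n]] C(2)] AE_I2) (simp add: h(2))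
  have "(\<lambda>w. k w * f w) \<in> Y" if f: "f \<in> X" for f
  proof -
    \<comment> \<open>Where \<open>f\<close> is negative, the products \<open>l n w * f w\<close>
      would decrease in \<open>n\<close>; the absolute value makes them increase everywhere.\<close>
    let ?f = "\<lambda>w. \<bar>f w\<bar>"
    have af: "?f \<in> X" using f by (rule X.abs_closed)
    have [measurable]: "f \<in> borel_measurable M" using f X.measurable by auto
    note k(1)[measurable]
    have "(\<lambda>w. k w * ?f w) \<in> Y"
    proof (rule fatou[unfolded fatou_property_def, rule_format, of "\<lambda>n w. l n w * ?f w"],
        intro conjI allI)
      show "(\<lambda>w. l n w * ?f w) \<in> Y" for n using l af by (simp add: multipliers_def)
      show "AE w in M. l n w * ?f w \<le> l (Suc n) w * ?f w" for n
        by (intro AE_I2 mult_right_mono l_mono) simp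
      show "\<exists>D. \<forall>n. NY (\<lambda>w. l n w * ?f w) \<le> D"
        using multiplier_norm_bound[OF l Cl C(1) af] by blast
      show "AE w in M. (\<lambda>n. l n w * ?f w) \<longlonglongrightarrow> k w * ?f w"
        using k(2) by eventually_elim (intro tendsto_intros l_lim)
    qed simp
    \<comment> \<open>Products with \<open>f\<close> and with its absolute value have the same
      modulus, so the ideal property returns to \<open>f\<close>.\<close>
    then show ?thesis by (rule Y.ideal) (auto simp: abs_mult)
  qed
  then show ?thesis using k(1) by (simp add: multipliers_def)
qed

text \<open>The norm of the multiplier 1 is that of the inclusion of \<open>X\<close> in
  \<open>Y\<close>. Homogeneity allows a constant to be chosen with a prescribed multiplier
  norm.\<close>

lemma multiplier_norm_const:
  assumes "X \<subseteq> Y" "0 \<le> c"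
  shows "multiplier_norm X NX NY (\<lambda>_. c) = ennreal c * multiplier_norm X NX NY (\<lambda>_. 1)"
proof -
  have "ennreal (NY (\<lambda>w. c * f w)) = ennreal c * ennreal (NY (\<lambda>w. 1 * f w))" if "f \<in> X" for f
  proof -
    have "f \<in> Y" using assms that by auto
    then show ?thesis using assms(2) Y.norm_scale[of f c] Y.norm_nonneg[of f]
      by (simp add: ennreal_mult)
  qed
  then show ?thesis unfolding multiplier_norm_def
    by (subst SUP_mult_left_ennreal) (auto intro!: SUP_cong)
qed

text \<open>If the inclusion has norm 0, the constant 1 has norm 0 in \<open>Y\<close> and vanishes
  a.e. The measure is then null, and every property holds a.e.\<close>

lemma multiplier_norm_one_eq_0D:
  assumes sub: "X \<subseteq> Y" and zero: "multiplier_norm X NX NY (\<lambda>_. 1) = 0"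
    and h: "h \<in> multipliers M X Y"
  shows "multiplier_norm X NX NY h = 0"
proof -
  have one: "(\<lambda>_. 1) \<in> multipliers M X Y"
    using Linfty_subset_multipliers[OF sub] const_mem_Linfty by blast
  have "NY (\<lambda>w. 1 * 1) \<le> 0 * NX (\<lambda>_. 1)"
    by (rule multiplier_norm_bound[OF one _ _ X.const_mem]) (simp_all add: zero)
  then have "AE w in M. (1 :: real) = 0"
    using Y.norm_eq_0_iff[OF Y.const_mem[of 1]] Y.norm_nonneg[OF Y.const_mem[of 1]] by simp
  then have null: "AE w in M. P w" for P by eventually_elim simp
  have "NY (\<lambda>w. h w * f w) = 0" if "f \<in> X" for f
    using h that Y.norm_eq_0_iff null by (simp add: multipliers_def)
  then show ?thesis unfolding multiplier_norm_def
    by (intro antisym SUP_least) auto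
qed

section \<open>Bounded approximation and passage to the limit\<close>

lemma bounded_approximation_ex:
  fixes \<Phi> :: "'a \<Rightarrow> lip0"
  assumes sub: "X \<subseteq> Y" and \<Phi>: "\<Phi> \<in> vector_valued M (multipliers M X Y)"
  shows "\<exists>\<Phi>n. (\<forall>n :: nat. \<Phi>n n \<in> vector_valued M (Linfty M)) \<and>
    (AE w in M. (\<lambda>n. norm (\<Phi>n n w - \<Phi> w)) \<longlonglongrightarrow> 0) \<and>
    (SUP n. multiplier_norm X NX NY (\<lambda>w. norm (\<Phi>n n w))) =
      multiplier_norm X NX NY (\<lambda>w. norm (\<Phi> w))"
proof -
  let ?m = "multiplier_norm X NX NY"
  define h where "h w = norm (\<Phi> w)" for w
  have sm: "strongly_measurable M \<Phi>" and h: "h \<in> multipliers M X Y"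
    using \<Phi> by (auto simp: vector_valued_def h_def[abs_def])
  have [measurable]: "h \<in> borel_measurable M" using h by (simp add: multipliers_def)
  have one: "(\<lambda>_. 1) \<in> multipliers M X Y"
    using Linfty_subset_multipliers[OF sub] const_mem_Linfty by blast
  obtain a where a: "?m (\<lambda>_. 1) = ennreal a" "0 \<le> a"
    using multiplier_norm_finite[OF one] by (cases "?m (\<lambda>_. 1)") auto
  obtain b where b: "?m h = ennreal b" "0 \<le> b"
    using multiplier_norm_finite[OF h] by (cases "?m h") auto
  obtain \<iota> :: lip0 where \<iota>: "norm \<iota> = 1" using lip0_norm_one_ex by blast
  \<comment> \<open>If \<open>a = 0\<close>, then \<open>M\<close> is the null measure, so that \<open>b = 0 = b / a\<close>.\<close>
  have c: "?m (\<lambda>_. b / a) = ennreal b"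
  proof (cases "a = 0")
    case True
    then show ?thesis
      using multiplier_norm_one_eq_0D[OF sub _ h] a b multiplier_norm_const[OF sub, of "b / a"]
      by simp
  next
    case False
    then show ?thesis using a b multiplier_norm_const[OF sub, of "b / a"]
      by (simp flip: ennreal_mult)
  qed
  define A where "A n = {w \<in> space M. h w \<le> real n}" for n
  have A: "A n \<in> sets M" for n unfolding A_def by measurable
  define \<Phi>n where "\<Phi>n n = (if n = 0 then (\<lambda>_. (b / a) *\<^sub>R \<iota>) else (\<lambda>w. indicator (A n) w *\<^sub>R \<Phi> w))"
    for n :: nat
  have norm_0: "(\<lambda>w. norm (\<Phi>n 0 w)) = (\<lambda>_. b / a)" using \<iota> a b by (simp add: \<Phi>n_def)
  have norm_truncation: "(\<lambda>w. norm (\<Phi>n n w)) = (\<lambda>w. indicator (A n) w * h w)" if "n \<noteq> 0" for n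
    using that by (simp add: \<Phi>n_def h_def)
  have sm_n: "strongly_measurable M (\<Phi>n n)" for n
    using strongly_measurable_const[of M "(b / a) *\<^sub>R \<iota>"]
      strongly_measurable_indicator_scaleR[OF sm A[of n]]
    by (simp add: \<Phi>n_def)
  have L: "(\<lambda>w. norm (\<Phi>n n w)) \<in> Linfty M" for n
  proof (cases "n = 0")
    case True
    then show ?thesis by (simp only: norm_0 const_mem_Linfty)
  next
    case False
    have "AE w in M. \<bar>indicator (A n) w * h w\<bar> \<le> real n"
      by (intro AE_I2) (auto simp: A_def indicator_def h_def)
    then show ?thesis using A by (auto simp: norm_truncation[OF False] Linfty_def)
  qed
  have le: "?m (\<lambda>w. norm (\<Phi>n n w)) \<le> ?m h" for n
  proof (cases "n = 0")
    case True
    then show ?thesis by (simp add: norm_0 c b)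
  next
    case False
    have "AE w in M. \<bar>norm (\<Phi>n n w)\<bar> \<le> \<bar>h w\<bar>"
      using False by (intro AE_I2) (auto simp: \<Phi>n_def h_def indicator_def)
    then show ?thesis using L Linfty_subset_multipliers[OF sub] h
      by (intro multiplier_norm_mono) auto
  qed
  have "AE w in M. (\<lambda>n. norm (\<Phi>n n w - \<Phi> w)) \<longlonglongrightarrow> 0"
  proof (rule AE_I2)
    fix w assume w: "w \<in> space M"
    obtain K where K: "h w \<le> real K" using real_arch_simple by blast
    \<comment> \<open>From \<open>K\<close> on, \<open>w\<close> lies in \<open>A n\<close>;
      starting at \<open>Suc K\<close> also skips index 0, which carries the constant
      function.\<close>
    have "norm (\<Phi>n n w - \<Phi> w) = 0" if "n \<ge> Suc K" for n
      using that K w by (auto simp: \<Phi>n_def A_def)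
    then show "(\<lambda>n. norm (\<Phi>n n w - \<Phi> w)) \<longlonglongrightarrow> 0"
      by (intro tendsto_eventually eventually_sequentiallyI[of "Suc K"])
  qed
  \<comment> \<open>Every term is bounded by \<open>?m h\<close>, and index 0 attains this
    value.\<close>
  moreover have "(SUP n. ?m (\<lambda>w. norm (\<Phi>n n w))) = ?m h"
    using le c b by (intro antisym SUP_least SUP_upper2[of 0]) (simp_all add: norm_0)
  ultimately show ?thesis
    using sm_n L by (intro exI[of _ \<Phi>n]) (simp add: vector_valued_def h_def[abs_def])
qed

text \<open>The problem is scalar: the norms of the approximants converge a.e. to the norm of
  \<open>\<Phi>\<close>, which is measurable by completeness, and the finite supremum is their
  common bound.\<close>

lemma vector_valued_limit:
  fixes \<Phi> :: "'a \<Rightarrow> 'e :: banach"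
  assumes "complete_measure M" and sub: "X \<subseteq> Y" and fatou: "fatou_property M Y NY"
    and sm: "strongly_measurable M \<Phi>"
    and L: "\<And>n :: nat. \<Phi>n n \<in> vector_valued M (Linfty M)"
    and lim: "AE w in M. (\<lambda>n. norm (\<Phi>n n w - \<Phi> w)) \<longlonglongrightarrow> 0"
    and fin: "(SUP n. multiplier_norm X NX NY (\<lambda>w. norm (\<Phi>n n w))) < \<infinity>"
  shows "\<Phi> \<in> vector_valued M (multipliers M X Y)"
proof -
  interpret complete_measure M by fact
  obtain C where C: "(SUP n. multiplier_norm X NX NY (\<lambda>w. norm (\<Phi>n n w))) = ennreal C" "0 \<le> C"
    using fin by (cases "SUP n. multiplier_norm X NX NY (\<lambda>w. norm (\<Phi>n n w))") auto
  have "(\<lambda>w. norm (\<Phi> w)) \<in> multipliers M X Y"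
  proof (rule multipliers_liminf[OF sub fatou, where h = "\<lambda>n w. norm (\<Phi>n n w)"])
    show "(\<lambda>w. norm (\<Phi>n n w)) \<in> multipliers M X Y" for n
      using L Linfty_subset_multipliers[OF sub] by (auto simp: vector_valued_def)
    show "multiplier_norm X NX NY (\<lambda>w. norm (\<Phi>n n w)) \<le> ennreal C" for n
      unfolding C(1)[symmetric] by (rule SUP_upper) simp
    show "(\<lambda>w. norm (\<Phi> w)) \<in> borel_measurable M" using sm by (rule strongly_measurable_norm)
    show "AE w in M. (\<lambda>n. norm (\<Phi>n n w)) \<longlonglongrightarrow> norm (\<Phi> w)"
      using lim by eventually_elim (metis LIM_zero_cancel tendsto_norm tendsto_norm_zero_iff)
  qed (use C in auto)
  then show ?thesis using sm by (simp add: vector_valued_def)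
qed

end

section \<open>The equivalence and the approximation of every representation\<close>

theorem theorem4p4:
  fixes M :: "'a measure"
    and X Y :: "('a \<Rightarrow> real) set"
    and NX NY :: "('a \<Rightarrow> real) \<Rightarrow> real"
    and T :: "('a \<Rightarrow> real) \<Rightarrow> 'a \<Rightarrow> real"
  assumes "complete_measure M"
    and "finite_measure M"
    and "banach_function_space M X NX"
    and "banach_function_space M Y NY"
    and "X \<subseteq> Y"
    and "fatou_property M Y NY"
    and "operator_between M X Y T"
  shows
    "(strongly_lattice_lipschitz M X Y T \<longleftrightarrow>
       (\<exists>\<Phi>. strongly_measurable M \<Phi> \<and> represented_by M X T \<Phi> \<and>
          (\<exists>\<Phi>n. (\<forall>n::nat. \<Phi>n n \<in> vector_valued M (Linfty M)) \<and>
             (AE w in M. (\<lambda>n. norm (\<Phi>n n w - \<Phi> w)) \<longlonglongrightarrow> 0) \<and>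
             (SUP n. multiplier_norm X NX NY (\<lambda>w. norm (\<Phi>n n w))) < \<infinity>)))
     \<and>
     (strongly_lattice_lipschitz M X Y T \<longrightarrow>
       (\<forall>\<Phi>. strongly_measurable M \<Phi> \<and> represented_by M X T \<Phi> \<longrightarrow>
          \<Phi> \<in> vector_valued M (multipliers M X Y) \<and>
          multiplier_norm X NX NY (\<lambda>w. norm (\<Phi> w)) < \<infinity> \<and>
          (\<exists>\<Phi>n. (\<forall>n::nat. \<Phi>n n \<in> vector_valued M (Linfty M)) \<and>
             (AE w in M. (\<lambda>n. norm (\<Phi>n n w - \<Phi> w)) \<longlonglongrightarrow> 0) \<and>
             (SUP n. multiplier_norm X NX NY (\<lambda>w. norm (\<Phi>n n w))) =
               multiplier_norm X NX NY (\<lambda>w. norm (\<Phi> w)))))"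
proof -
  interpret banach_function_space_pair M X NX Y NY
    using assms(3,4) by (rule banach_function_space_pair.intro)
  interpret complete_measure M by fact
  \<comment> \<open>The hypothesis yields some representation \<open>\<Psi>\<close> with the
    required integrability; uniqueness transfers it to the given \<open>\<Phi>\<close>.\<close>
  have all: "\<Phi> \<in> vector_valued M (multipliers M X Y)"
    if sll: "strongly_lattice_lipschitz M X Y T"
      and sm: "strongly_measurable M \<Phi>" and rep: "represented_by M X T \<Phi>" for \<Phi>
  proof -
    obtain \<Psi> where \<Psi>: "\<Psi> \<in> vector_valued M (multipliers M X Y)" "represented_by M X T \<Psi>"
      using sll by (auto simp: strongly_lattice_lipschitz_def)
    have le: "AE w in M. \<bar>norm (\<Phi> w)\<bar> \<le> \<bar>norm (\<Psi> w)\<bar>"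
      using representation_unique[OF assms(3) rep \<Psi>(2)] by eventually_elim simp
    have "(\<lambda>w. norm (\<Psi> w)) \<in> multipliers M X Y" using \<Psi>(1) by (simp add: vector_valued_def)
    then have "(\<lambda>w. norm (\<Phi> w)) \<in> multipliers M X Y"
      using strongly_measurable_norm[OF sm] le by (rule multipliersI_AE_le)
    then show ?thesis using sm by (simp add: vector_valued_def)
  qed
  have fin: "multiplier_norm X NX NY (\<lambda>w. norm (\<Phi> w)) < \<infinity>"
    if "\<Phi> \<in> vector_valued M (multipliers M X Y)" for \<Phi> :: "'a \<Rightarrow> lip0"
    using that by (intro multiplier_norm_finite) (simp add: vector_valued_def)
  show ?thesis
  proof (intro conjI iffI impI allI)
    assume "strongly_lattice_lipschitz M X Y T"
    then obtain \<Phi> where \<Phi>: "\<Phi> \<in> vector_valued M (multipliers M X Y)" "represented_by M X T \<Phi>"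
      by (auto simp: strongly_lattice_lipschitz_def)
    then have sm: "strongly_measurable M \<Phi>" by (simp add: vector_valued_def)
    from bounded_approximation_ex[OF assms(5) \<Phi>(1)] obtain \<Phi>n where
      "\<forall>n::nat. \<Phi>n n \<in> vector_valued M (Linfty M)"
      "AE w in M. (\<lambda>n. norm (\<Phi>n n w - \<Phi> w)) \<longlonglongrightarrow> 0"
      and eq: "(SUP n. multiplier_norm X NX NY (\<lambda>w. norm (\<Phi>n n w))) =
        multiplier_norm X NX NY (\<lambda>w. norm (\<Phi> w))"
      by (elim exE conjE)
    then show "\<exists>\<Phi>. strongly_measurable M \<Phi> \<and> represented_by M X T \<Phi> \<and>
          (\<exists>\<Phi>n. (\<forall>n::nat. \<Phi>n n \<in> vector_valued M (Linfty M)) \<and>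
             (AE w in M. (\<lambda>n. norm (\<Phi>n n w - \<Phi> w)) \<longlonglongrightarrow> 0) \<and>
             (SUP n. multiplier_norm X NX NY (\<lambda>w. norm (\<Phi>n n w))) < \<infinity>)"
      \<comment> \<open>By \<open>eq\<close>, finiteness of the multiplier norm of
        \<open>\<Phi>\<close> is finiteness of the supremum.\<close>
      using sm \<Phi>(2) fin[OF \<Phi>(1), folded eq]
      by (intro exI[of _ \<Phi>] exI[of _ \<Phi>n] conjI)
  next
    assume "\<exists>\<Phi>. strongly_measurable M \<Phi> \<and> represented_by M X T \<Phi> \<and>
          (\<exists>\<Phi>n. (\<forall>n::nat. \<Phi>n n \<in> vector_valued M (Linfty M)) \<and>
             (AE w in M. (\<lambda>n. norm (\<Phi>n n w - \<Phi> w)) \<longlonglongrightarrow> 0) \<and>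
             (SUP n. multiplier_norm X NX NY (\<lambda>w. norm (\<Phi>n n w))) < \<infinity>)"
    then obtain \<Phi> \<Phi>n where "strongly_measurable M \<Phi>" and rep: "represented_by M X T \<Phi>"
      and "\<forall>n::nat. \<Phi>n n \<in> vector_valued M (Linfty M)"
        "AE w in M. (\<lambda>n. norm (\<Phi>n n w - \<Phi> w)) \<longlonglongrightarrow> 0"
        "(SUP n. multiplier_norm X NX NY (\<lambda>w. norm (\<Phi>n n w))) < \<infinity>"
      by (elim exE conjE)
    then have "\<Phi> \<in> vector_valued M (multipliers M X Y)"
      by (intro vector_valued_limit[OF assms(1,5,6), of \<Phi> \<Phi>n]) simp_all
    with rep show "strongly_lattice_lipschitz M X Y T"
      unfolding strongly_lattice_lipschitz_def by (rule rev_bexI[rotated])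
  next
    fix \<Phi>
    assume "strongly_lattice_lipschitz M X Y T"
      and "strongly_measurable M \<Phi> \<and> represented_by M X T \<Phi>"
    then have \<Phi>: "\<Phi> \<in> vector_valued M (multipliers M X Y)" using all by simp
    show "\<Phi> \<in> vector_valued M (multipliers M X Y)"
      and "multiplier_norm X NX NY (\<lambda>w. norm (\<Phi> w)) < \<infinity>"
      and "\<exists>\<Phi>n. (\<forall>n::nat. \<Phi>n n \<in> vector_valued M (Linfty M)) \<and>
             (AE w in M. (\<lambda>n. norm (\<Phi>n n w - \<Phi> w)) \<longlonglongrightarrow> 0) \<and>
             (SUP n. multiplier_norm X NX NY (\<lambda>w. norm (\<Phi>n n w))) =
               multiplier_norm X NX NY (\<lambda>w. norm (\<Phi> w))"
      using \<Phi> fin[OF \<Phi>] bounded_approximation_ex[OF assms(5) \<Phi>] by this+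
  qed
qed

end
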